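(* Let $G$ be an $n \times n$ bipartite graph (with $n \geq 1$). Then \[ \beta(G) \geq \left\lfloor \frac{1}{2} \cdot \sum_{v \in V(G)} \frac{1}{d(v)+1} \right\rfloor, \] where $d(v)$ denotes the degree of $v$ in $G$.
   Context: An $n \times n$ bipartite graph is a bipartite graph $G=(A,B,E)$ with a fixed bipartition into parts $A$ and $B$ satisfying $|A|=|B|=n$. A bi-hole of size $t$ in $G$ is a pair of sets $X \subseteq A$, $Y \subseteq B$ with $|X|=|Y|=t$ such that there is no edge of $G$ between any vertex of $X$ and any vertex of $Y$ (i.e., a copy of $K_{t,t}$ in the bipartite complement of $G$). $\beta(G)$ denotes the largest $k$ for which $G$ has a bi-hole of size $k$. *)

theory Defs
  imports Complex_Main
begin

definition bipartite_nn :: "nat \<Rightarrow> 'a set \<Rightarrow> 'a set \<Rightarrow> 'a set set \<Rightarrow> bool" where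
  "bipartite_nn n A B E \<longleftrightarrow>
     finite A \<and> finite B \<and> A \<inter> B = {} \<and> card A = n \<and> card B = n \<and>
     E \<subseteq> {{a, b} | a b. a \<in> A \<and> b \<in> B}"

definition vertex_degree :: "'a set set \<Rightarrow> 'a \<Rightarrow> nat" where
  "vertex_degree E v = card {e \<in> E. v \<in> e}"

definition bi_hole :: "'a set \<Rightarrow> 'a set \<Rightarrow> 'a set set \<Rightarrow> nat \<Rightarrow> 'a set \<Rightarrow> 'a set \<Rightarrow> bool" where
  "bi_hole A B E t X Y \<longleftrightarrow>
     X \<subseteq> A \<and> Y \<subseteq> B \<and> card X = t \<and> card Y = t \<and> (\<forall>x\<in>X. \<forall>y\<in>Y. {x, y} \<notin> E)"

definition bi_hole_number :: "'a set \<Rightarrow> 'a set \<Rightarrow> 'a set set \<Rightarrow> nat" where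
  "bi_hole_number A B E = Max {k. \<exists>X Y. bi_hole A B E k X Y}"

text \<open>The maximum is taken over a nonempty finite set, so it is attained.\<close>

lemma bi_hole_sizes_nonempty: "{k. \<exists>X Y. bi_hole A B E k X Y} \<noteq> {}"
proof -
  have "bi_hole A B E 0 {} {}" by (simp add: bi_hole_def)
  then show ?thesis by blast
qed

lemma bi_hole_sizes_finite:
  assumes "finite A"
  shows "finite {k. \<exists>X Y. bi_hole A B E k X Y}"
proof (rule finite_subset)
  show "{k. \<exists>X Y. bi_hole A B E k X Y} \<subseteq> {..card A}"
    using assms by (auto simp: bi_hole_def intro: card_mono)
qed simp

end

theory Submission
  imports Defs
begin

text \<open>
  One of the two sides, say \<open>A\<close>, carries at least half of the sum. Weighting each \<open>a \<in> A\<close> by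
  \<open>1/(d(a)+1)\<close> is a fractional choice of at least \<open>t\<close> vertices, where \<open>t\<close> is the claimed bound, at
  cost \<open>d(a)+1\<close> each and total cost \<open>n\<close>. The \<open>t\<close> cheapest vertices cost no more than any such
  fractional choice, so they have at most \<open>n - t\<close> neighbours, and \<open>t\<close> vertices of \<open>B\<close> remain.
\<close>

lemma obtain_least_subset_with_card:
  fixes f :: "'a \<Rightarrow> 'b::linorder"
  assumes "finite A" and "k \<le> card A"
  obtains X where "X \<subseteq> A" and "card X = k" and "\<And>x y. x \<in> X \<Longrightarrow> y \<in> A - X \<Longrightarrow> f x \<le> f y"
proof -
  have "\<exists>X\<subseteq>A. card X = k \<and> (\<forall>x\<in>X. \<forall>y\<in>A - X. f x \<le> f y)"
    using assms(2)
  proof (induction k)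
    case 0
    show ?case by (intro exI[of _ "{}"]) simp
  next
    case (Suc k)
    then obtain X where X: "X \<subseteq> A" "card X = k" and below: "\<forall>x\<in>X. \<forall>y\<in>A - X. f x \<le> f y"
      by auto
    have "finite X" and "finite (A - X)"
      using X(1) assms(1) finite_subset by auto
    have "A - X \<noteq> {}"
      using X Suc.prems by auto
    define a where "a = arg_min_on f (A - X)"
    have a: "a \<in> A - X" and a_least: "\<forall>y\<in>A - X. f a \<le> f y"
      unfolding a_def using \<open>finite (A - X)\<close> \<open>A - X \<noteq> {}\<close>
      by (auto intro: arg_min_least dest: arg_min_if_finite(1))
    have "insert a X \<subseteq> A" and "card (insert a X) = Suc k"
      using X a \<open>finite X\<close> by auto
    moreover have "\<forall>x\<in>insert a X. \<forall>y\<in>A - insert a X. f x \<le> f y"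
      using below a_least by auto
    ultimately show ?case
      by blast
  qed
  then show thesis
    using that by blast
qed

lemma sum_subset_le_weighted_sum:
  fixes f w :: "'a \<Rightarrow> 'b::linordered_idom"
  assumes "finite A" and "X \<subseteq> A" and "0 \<le> c"
    and below: "\<And>a. a \<in> X \<Longrightarrow> f a \<le> c"
    and above: "\<And>a. a \<in> A - X \<Longrightarrow> c \<le> f a"
    and weight: "\<And>a. a \<in> A \<Longrightarrow> 0 \<le> w a" "\<And>a. a \<in> A \<Longrightarrow> w a \<le> 1"
    and card_le: "of_nat (card X) \<le> sum w A"
  shows "sum f X \<le> (\<Sum>a\<in>A. w a * f a)"
proof -
  define u :: "'a \<Rightarrow> 'b" where "u a = of_bool (a \<in> X)" for a
  have sum_u: "(\<Sum>a\<in>A. u a * g a) = sum g X" for g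
    unfolding u_def using assms(1,2) by (simp add: sum_of_bool_mult_eq Int_absorb1)
  have "(u a - w a) * (f a - c) \<le> 0" if "a \<in> A" for a
  proof (cases "a \<in> X")
    case True
    then show ?thesis
      using below weight(2)[OF that] by (intro mult_nonneg_nonpos) (auto simp: u_def)
  next
    case False
    then show ?thesis
      using above weight(1)[OF that] that by (intro mult_nonpos_nonneg) (auto simp: u_def)
  qed
  then have "(\<Sum>a\<in>A. (u a - w a) * (f a - c)) \<le> 0"
    by (rule sum_nonpos)
  also have "(\<Sum>a\<in>A. (u a - w a) * (f a - c))
      = sum f X - (\<Sum>a\<in>A. w a * f a) - c * (of_nat (card X) - sum w A)"
    using sum_u[of f] sum_u[of "\<lambda>_. c"]
    by (simp add: algebra_simps sum.distrib sum_subtractf sum_distrib_left)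
  finally have "sum f X - (\<Sum>a\<in>A. w a * f a) \<le> c * (of_nat (card X) - sum w A)"
    by simp
  also have "\<dots> \<le> 0"
    using \<open>0 \<le> c\<close> card_le by (intro mult_nonneg_nonpos) auto
  finally show ?thesis
    by simp
qed

lemma obtain_subset_sum_le_weighted_sum:
  fixes f w :: "'a \<Rightarrow> 'b::linordered_idom"
  assumes "finite A"
    and nonneg: "\<And>a. a \<in> A \<Longrightarrow> 0 \<le> f a"
    and weight: "\<And>a. a \<in> A \<Longrightarrow> 0 \<le> w a" "\<And>a. a \<in> A \<Longrightarrow> w a \<le> 1"
    and card_le: "of_nat k \<le> sum w A"
  obtains X where "X \<subseteq> A" and "card X = k" and "sum f X \<le> (\<Sum>a\<in>A. w a * f a)"
proof -
  have "sum w A \<le> of_nat (card A)"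
    using sum_bounded_above[of A w 1] weight(2) by simp
  with card_le have "k \<le> card A"
    using of_nat_le_iff order_trans by blast
  with \<open>finite A\<close> obtain X where X: "X \<subseteq> A" "card X = k"
    and least: "\<And>x y. x \<in> X \<Longrightarrow> y \<in> A - X \<Longrightarrow> f x \<le> f y"
    using obtain_least_subset_with_card[of A k f] by blast
  have "sum f X \<le> (\<Sum>a\<in>A. w a * f a)"
  proof (cases "X = {}")
    case True
    then show ?thesis
      using nonneg weight(1) by (simp add: sum_nonneg)
  next
    case False
    have "finite X"
      using X(1) \<open>finite A\<close> by (rule finite_subset)
    then obtain x where x: "x \<in> X" "f x = Max (f ` X)"
      using False Max_in[of "f ` X"] by fastforce
    have "0 \<le> f x"
      using x(1) X(1) nonneg by blast
    moreover have "f a \<le> f x" if "a \<in> X" for a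
      using x(2) \<open>finite X\<close> that by simp
    ultimately show ?thesis
      using sum_subset_le_weighted_sum[OF \<open>finite A\<close> X(1), of "f x" f w]
        least x(1) weight card_le X(2)
      by blast
  qed
  with X show thesis
    by (rule that)
qed

definition neighbours :: "'a set set \<Rightarrow> 'a \<Rightarrow> 'a set" where
  "neighbours E v = {u. {v, u} \<in> E}"

lemma
  assumes "finite E"
  shows finite_neighbours: "finite (neighbours E v)"
    and card_neighbours_le_vertex_degree: "card (neighbours E v) \<le> vertex_degree E v"
proof -
  have inj: "inj_on (\<lambda>u. {v, u}) (neighbours E v)"
    by (auto simp: inj_on_def doubleton_eq_iff)
  have image: "(\<lambda>u. {v, u}) ` neighbours E v \<subseteq> {e \<in> E. v \<in> e}"
    by (auto simp: neighbours_def)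
  have fin: "finite {e \<in> E. v \<in> e}"
    using assms by simp
  show "finite (neighbours E v)"
    using inj image fin by (rule inj_on_finite)
  show "card (neighbours E v) \<le> vertex_degree E v"
    unfolding vertex_degree_def using inj image fin by (rule card_inj_on_le)
qed

lemma bi_hole_of_sum_degree_le:
  assumes "finite X" "finite E" "X \<subseteq> A"
    and degrees: "(\<Sum>x\<in>X. vertex_degree E x + 1) \<le> card B"
  shows "\<exists>Y. bi_hole A B E (card X) X Y"
proof -
  define N where "N = (\<Union>x\<in>X. neighbours E x)"
  have "finite N"
    using assms(1,2) by (simp add: N_def finite_neighbours)
  have "card N \<le> (\<Sum>x\<in>X. card (neighbours E x))"
    unfolding N_def by (rule card_UN_le[OF \<open>finite X\<close>])
  also have "\<dots> \<le> (\<Sum>x\<in>X. vertex_degree E x)"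
    by (intro sum_mono card_neighbours_le_vertex_degree \<open>finite E\<close>)
  finally have "card X \<le> card B - card N"
    using degrees by (simp add: sum_Suc)
  also have "\<dots> \<le> card (B - N)"
    using \<open>finite N\<close> by (rule diff_card_le_card_Diff)
  finally obtain Y where "Y \<subseteq> B - N" and "card Y = card X"
    by (rule obtain_subset_with_card_n)
  then have "bi_hole A B E (card X) X Y"
    using \<open>X \<subseteq> A\<close> by (auto simp: bi_hole_def N_def neighbours_def)
  then show ?thesis ..
qed

lemma le_bi_hole_number:
  assumes "finite A" and "bi_hole A B E k X Y"
  shows "k \<le> bi_hole_number A B E"
  unfolding bi_hole_number_def using assms by (auto intro: Max_ge bi_hole_sizes_finite)

lemma bi_hole_commute: "bi_hole A B E k X Y \<longleftrightarrow> bi_hole B A E k Y X"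
  unfolding bi_hole_def by (metis insert_commute)

lemma bi_hole_number_commute: "bi_hole_number A B E = bi_hole_number B A E"
proof -
  have "(\<exists>X Y. bi_hole A B E k X Y) \<longleftrightarrow> (\<exists>X Y. bi_hole B A E k X Y)" for k
    using bi_hole_commute by blast
  then show ?thesis
    by (simp add: bi_hole_number_def)
qed

definition caro_wei_sum :: "'a set set \<Rightarrow> 'a set \<Rightarrow> real" where
  "caro_wei_sum E V = (\<Sum>v\<in>V. 1 / (real (vertex_degree E v) + 1))"

lemma floor_caro_wei_sum_le_bi_hole_number:
  assumes "finite A" "finite E" "card A \<le> card B"
  shows "\<lfloor>caro_wei_sum E A\<rfloor> \<le> int (bi_hole_number A B E)"
proof -
  define k where "k = nat \<lfloor>caro_wei_sum E A\<rfloor>"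
  have "0 \<le> caro_wei_sum E A"
    by (simp add: caro_wei_sum_def sum_nonneg)
  then have "real k \<le> (\<Sum>a\<in>A. 1 / (real (vertex_degree E a) + 1))"
    unfolding k_def caro_wei_sum_def by (rule of_nat_floor)
  with \<open>finite A\<close> obtain X where X: "X \<subseteq> A" "card X = k"
    and cost: "(\<Sum>x\<in>X. real (vertex_degree E x) + 1)
      \<le> (\<Sum>a\<in>A. 1 / (real (vertex_degree E a) + 1) * (real (vertex_degree E a) + 1))"
    using obtain_subset_sum_le_weighted_sum
      [of A "\<lambda>v. real (vertex_degree E v) + 1" "\<lambda>v. 1 / (real (vertex_degree E v) + 1)" k]
    by auto
  note cost
  also have "(\<Sum>a\<in>A. 1 / (real (vertex_degree E a) + 1) * (real (vertex_degree E a) + 1))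
      = real (card A)"
    by (simp add: add_nonneg_eq_0_iff)
  finally have "real (\<Sum>x\<in>X. vertex_degree E x + 1) \<le> real (card A)"
    by (simp add: add.commute)
  then have "(\<Sum>x\<in>X. vertex_degree E x + 1) \<le> card B"
    using assms(3) by linarith
  then obtain Y where "bi_hole A B E k X Y"
    using bi_hole_of_sum_degree_le X assms(1,2) finite_subset by metis
  then have "k \<le> bi_hole_number A B E"
    by (rule le_bi_hole_number[OF \<open>finite A\<close>])
  then show ?thesis
    by (simp add: k_def)
qed

lemma bipartite_nn_imp_finite_edges:
  assumes "bipartite_nn n A B E"
  shows "finite E"
proof (rule finite_subset)
  show "E \<subseteq> Pow (A \<union> B)"
    using assms by (auto simp: bipartite_nn_def)
  show "finite (Pow (A \<union> B))"
    using assms by (simp add: bipartite_nn_def)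
qed

theorem theorem2:
  fixes A B :: "'a set" and E :: "'a set set" and n :: nat
  assumes "n \<ge> 1"
    and "bipartite_nn n A B E"
  shows "int (bi_hole_number A B E) \<ge>
    \<lfloor>(1 / 2) * (\<Sum>v \<in> A \<union> B. 1 / (real (vertex_degree E v) + 1))\<rfloor>"
proof -
  have sides: "finite A" "finite B" "A \<inter> B = {}" "card A = card B" and "finite E"
    using assms(2) bipartite_nn_imp_finite_edges by (auto simp: bipartite_nn_def)
  have "caro_wei_sum E (A \<union> B) = caro_wei_sum E A + caro_wei_sum E B"
    unfolding caro_wei_sum_def using sides(1-3) by (rule sum.union_disjoint)
  then have "1 / 2 * caro_wei_sum E (A \<union> B) \<le> max (caro_wei_sum E A) (caro_wei_sum E B)"
    by simp
  then have "\<lfloor>1 / 2 * caro_wei_sum E (A \<union> B)\<rfloor>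
      \<le> \<lfloor>max (caro_wei_sum E A) (caro_wei_sum E B)\<rfloor>"
    by (rule floor_mono)
  also have "\<dots> = max \<lfloor>caro_wei_sum E A\<rfloor> \<lfloor>caro_wei_sum E B\<rfloor>"
    by (simp add: max_of_mono monoI floor_mono)
  also have "\<dots> \<le> int (bi_hole_number A B E)"
    using floor_caro_wei_sum_le_bi_hole_number[of A E B]
      floor_caro_wei_sum_le_bi_hole_number[of B E A] sides \<open>finite E\<close>
    by (simp add: bi_hole_number_commute[of B A])
  finally show ?thesis
    by (simp add: caro_wei_sum_def)
qed

end
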